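(* For every integer $n\geq 1$ there is a Boolean network $f:\{0,1\}^n\to\{0,1\}^n$ such that every digraph in $\mathcal{G}(f)$ has at least $n^2/9$ arcs.
   Context: A Boolean network with $n$ components is a map $f:\{0,1\}^n\to\{0,1\}^n$, $x\mapsto(f_1(x),\dots,f_n(x))$. For $i\in[n]=\{1,\dots,n\}$, $e_i$ denotes the configuration with a $1$ exactly in component $i$, and $x+y$ denotes componentwise addition modulo 2. The interaction graph $G(f)$ is the digraph with vertex set $[n]$ having an arc from $j$ to $i$ (loops $i=j$ allowed) if and only if there is $x\in\{0,1\}^n$ with $f_i(x)\neq f_i(x+e_j)$. Two networks $f,h$ with $n$ components are isomorphic if $h\circ\pi=\pi\circ f$ for some permutation $\pi$ of $\{0,1\}^n$. $\mathcal{G}(f)$ is the set of interaction graphs $G(h)$ of all networks $h$ isomorphic to $f$. *)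

theory Defs
  imports
    Complex_Main
    "HOL-Library.FuncSet"
    "HOL-Library.Z2"
    "HOL-Combinatorics.Permutations"
    "Graph_Theory.Pair_Digraph"
begin

text \<open>
  Configurations are the extensional functions from \<open>{1..n}\<close> to the two-element field
  \<open>bit\<close>, so that addition modulo 2 is addition of \<open>bit\<close>.
\<close>

definition config :: "nat \<Rightarrow> (nat \<Rightarrow> bit) set" where
  "config n = {1..n} \<rightarrow>\<^sub>E UNIV"

definition unit_config :: "nat \<Rightarrow> nat \<Rightarrow> nat \<Rightarrow> bit" where
  "unit_config n j = (\<lambda>i\<in>{1..n}. if i = j then 1 else 0)"

definition add_config :: "nat \<Rightarrow> (nat \<Rightarrow> bit) \<Rightarrow> (nat \<Rightarrow> bit) \<Rightarrow> nat \<Rightarrow> bit" where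
  "add_config n x y = (\<lambda>i\<in>{1..n}. x i + y i)"

text \<open>The values of a network outside \<open>config n\<close> are arbitrary and never used.\<close>

definition boolean_network :: "nat \<Rightarrow> ((nat \<Rightarrow> bit) \<Rightarrow> nat \<Rightarrow> bit) \<Rightarrow> bool" where
  "boolean_network n f \<longleftrightarrow> f \<in> config n \<rightarrow> config n"

text \<open>The pair \<open>(j, i)\<close> is the arc from \<open>j\<close> to \<open>i\<close>; loops are allowed.\<close>

definition interaction_graph ::
    "nat \<Rightarrow> ((nat \<Rightarrow> bit) \<Rightarrow> nat \<Rightarrow> bit) \<Rightarrow> nat pair_pre_digraph" where
  "interaction_graph n f =
    \<lparr> pverts = {1..n},
      parcs = {(j, i). j \<in> {1..n} \<and> i \<in> {1..n} \<and>
        (\<exists>x\<in>config n. f x i \<noteq> f (add_config n x (unit_config n j)) i)} \<rparr>"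

definition isomorphic_networks ::
    "nat \<Rightarrow> ((nat \<Rightarrow> bit) \<Rightarrow> nat \<Rightarrow> bit) \<Rightarrow> ((nat \<Rightarrow> bit) \<Rightarrow> nat \<Rightarrow> bit) \<Rightarrow> bool" where
  "isomorphic_networks n f h \<longleftrightarrow>
    (\<exists>\<pi>. \<pi> permutes config n \<and> (\<forall>x\<in>config n. h (\<pi> x) = \<pi> (f x)))"

definition interaction_graphs ::
    "nat \<Rightarrow> ((nat \<Rightarrow> bit) \<Rightarrow> nat \<Rightarrow> bit) \<Rightarrow> nat pair_pre_digraph set" where
  "interaction_graphs n f =
    {interaction_graph n h | h. boolean_network n h \<and> isomorphic_networks n f h}"

lemma finite_config [simp]: "finite (config n)"
  unfolding config_def by (intro finite_PiE) (auto intro: finite_subset[of _ "{0, 1}"])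

lemma add_config_in_config [simp]: "add_config n x y \<in> config n"
  by (simp add: config_def add_config_def)

lemma unit_config_in_config [simp]: "unit_config n j \<in> config n"
  by (simp add: config_def unit_config_def)

lemma pair_fin_digraph_interaction_graph: "pair_fin_digraph (interaction_graph n f)"
proof
  have "parcs (interaction_graph n f) \<subseteq> {1..n} \<times> {1..n}"
    by (auto simp: interaction_graph_def)
  then show "finite (parcs (interaction_graph n f))"
    by (rule finite_subset) simp
qed (auto simp: interaction_graph_def)

lemma isomorphic_networks_refl: "isomorphic_networks n f f"
  unfolding isomorphic_networks_def by (rule exI[of _ id]) (simp add: permutes_id)

lemma interaction_graph_in_interaction_graphs:
  "boolean_network n f \<Longrightarrow> interaction_graph n f \<in> interaction_graphs n f"
  unfolding interaction_graphs_def using isomorphic_networks_refl by blast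

end

theory Submission
  imports Defs
begin

text \<open>
  Let \<open>m = \<lceil>n/2\<rceil>\<close>, and let \<open>f\<close> fix the points of a set \<open>A\<close> of \<open>2\<^sup>m\<close> configurations and map
  everything else to one point of \<open>A\<close>. A network \<open>h\<close> isomorphic to \<open>f\<close> also has \<open>2\<^sup>m\<close>
  values, so at least \<open>m\<close> of its components are not constant. All but one of its fibres are
  singletons, so each such component takes one of its two values on a nonempty set of fewer
  than \<open>2\<^sup>m\<close> configurations. A component with in-degree \<open>d\<close> attains each of its values at least
  \<open>2\<^bsup>n-d\<^esup>\<close> times, whence \<open>d \<ge> n - m + 1\<close> and \<open>G(h)\<close> has at least
  \<open>m (n - m + 1) \<ge> n\<^sup>2 / 4\<close> arcs.
\<close>

lemma UNIV_bit: "(UNIV :: bit set) = {0, 1}"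
  by auto

lemma card_UNIV_bit: "card (UNIV :: bit set) = 2"
  by (simp add: UNIV_bit)

lemma card_PiE_bit: "finite I \<Longrightarrow> card (I \<rightarrow>\<^sub>E (UNIV :: bit set)) = 2 ^ card I"
  by (simp add: card_PiE card_UNIV_bit)

lemma card_config: "card (config n) = 2 ^ n"
  by (simp add: config_def card_PiE_bit)

definition in_neighbours ::
    "nat \<Rightarrow> ((nat \<Rightarrow> bit) \<Rightarrow> nat \<Rightarrow> bit) \<Rightarrow> nat \<Rightarrow> nat set" where
  "in_neighbours n f i = {j. (j, i) \<in> parcs (interaction_graph n f)}"

lemma in_neighbours_subset: "in_neighbours n f i \<subseteq> {1..n}"
  by (auto simp: in_neighbours_def interaction_graph_def)

lemma card_arcs_ge:
  assumes "finite I" "\<And>i. i \<in> I \<Longrightarrow> d \<le> card (in_neighbours n f i)"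
  shows "card I * d \<le> card (parcs (interaction_graph n f))"
proof -
  have fin: "finite (in_neighbours n f i)" for i
    using in_neighbours_subset by (rule finite_subset) simp
  have "card I * d \<le> (\<Sum>i\<in>I. card (in_neighbours n f i))"
    using sum_bounded_below[of I d] assms(2) by simp
  also have "\<dots> = card (SIGMA i:I. in_neighbours n f i)"
    using assms(1) fin by simp
  \<comment> \<open>The pairs of the Sigma set have the head first, whereas arcs have the tail
    first.\<close>
  also have "\<dots> = card (prod.swap ` (SIGMA i:I. in_neighbours n f i))"
    by (simp add: card_image)
  also have "\<dots> \<le> card (parcs (interaction_graph n f))"
    using pair_fin_digraph.pair_finite_arcs[OF pair_fin_digraph_interaction_graph]
    by (rule card_mono) (auto simp: in_neighbours_def)
  finally show ?thesis .
qed

text \<open>The coordinates in \<open>S\<close> are flipped one at a time; none of them is an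
  in-neighbour of \<open>i\<close>, so no flip changes component \<open>i\<close>.\<close>

lemma add_config_indicator_invariant:
  assumes "x \<in> config n" "i \<in> {1..n}" "finite S" "S \<subseteq> {1..n} - in_neighbours n f i"
  shows "f (add_config n x (\<lambda>j. of_bool (j \<in> S))) i = f x i"
  using assms(3,4)
proof (induction S rule: finite_induct)
  case empty
  have "add_config n x (\<lambda>j. 0) = x"
    using assms(1) by (auto simp: add_config_def config_def PiE_def extensional_def)
  then show ?case by simp
next
  case (insert k S)
  let ?y = "add_config n x (\<lambda>j. of_bool (j \<in> S))"
  have "add_config n x (\<lambda>j. of_bool (j \<in> insert k S)) = add_config n ?y (unit_config n k)"
    using insert.hyps by (auto simp: add_config_def unit_config_def)
  then have "f (add_config n x (\<lambda>j. of_bool (j \<in> insert k S))) i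
      = f (add_config n ?y (unit_config n k)) i"
    by (rule arg_cong)
  also have "f (add_config n ?y (unit_config n k)) i = f ?y i"
  proof -
    have "k \<in> {1..n}" "(k, i) \<notin> parcs (interaction_graph n f)"
      using insert.prems by (simp_all add: in_neighbours_def)
    then have "\<forall>y\<in>config n. f y i = f (add_config n y (unit_config n k)) i"
      using assms(2) unfolding interaction_graph_def pair_pre_digraph.simps by blast
    then have "f ?y i = f (add_config n ?y (unit_config n k)) i"
      using add_config_in_config by (rule bspec)
    then show ?thesis by (rule sym)
  qed
  also have "f ?y i = f x i"
    using insert.IH insert.prems by blast
  finally show ?case .
qed

text \<open>Translating \<open>x\<close> by the indicators of the subsets of the non-in-neighbours
  of \<open>i\<close> gives distinct points of the level set.\<close>

lemma card_level_set_ge: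
  assumes "x \<in> config n" "i \<in> {1..n}"
  shows "2 ^ (n - card (in_neighbours n f i)) \<le> card {y \<in> config n. f y i = f x i}"
proof -
  let ?J = "{1..n} - in_neighbours n f i"
  let ?g = "\<lambda>S. add_config n x (\<lambda>j. of_bool (j \<in> S))"
  have "inj_on ?g (Pow ?J)"
  proof (rule inj_onI)
    fix S T assume S: "S \<in> Pow ?J" "T \<in> Pow ?J" and eq: "?g S = ?g T"
    have "j \<in> S \<longleftrightarrow> j \<in> T" if "j \<in> {1..n}" for j
    proof -
      have "x j + of_bool (j \<in> S) = x j + of_bool (j \<in> T)"
        using fun_cong[OF eq, of j] that by (simp only: add_config_def restrict_apply')
      then show ?thesis by (simp only: add_left_cancel of_bool_eq_iff)
    qed
    then show "S = T" using S by blast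
  qed
  moreover have "?g ` Pow ?J \<subseteq> {y \<in> config n. f y i = f x i}"
  proof (intro image_subsetI CollectI conjI add_config_in_config)
    fix S assume "S \<in> Pow ?J"
    then show "f (?g S) i = f x i"
      by (intro add_config_indicator_invariant[OF assms]) (auto intro: finite_subset)
  qed
  ultimately have "card (Pow ?J) \<le> card {y \<in> config n. f y i = f x i}"
    by (intro card_inj_on_le) auto
  moreover have "card ?J = n - card (in_neighbours n f i)"
    using in_neighbours_subset[of n f i] finite_subset[OF in_neighbours_subset]
    by (simp add: card_Diff_subset)
  ultimately show ?thesis by (simp add: card_Pow)
qed

text \<open>Outside the counted components every value of \<open>h\<close> agrees with
  \<open>c\<close>, so a value is determined by its restriction to them.\<close>

lemma card_image_le_nonconstant_components:
  assumes "boolean_network n h" "c \<in> config n"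
  shows "card (h ` config n) \<le> 2 ^ card {i \<in> {1..n}. \<exists>y\<in>config n. h y i \<noteq> c i}"
proof -
  let ?I = "{i \<in> {1..n}. \<exists>y\<in>config n. h y i \<noteq> c i}"
  have h: "h y \<in> config n" if "y \<in> config n" for y
    using assms(1) that by (auto simp: boolean_network_def)
  have "inj_on (\<lambda>z. restrict z ?I) (h ` config n)"
  proof (rule inj_onI, clarify)
    fix y z assume yz: "y \<in> config n" "z \<in> config n"
      and eq: "restrict (h y) ?I = restrict (h z) ?I"
    show "h y = h z"
    proof (rule PiE_ext)
      show "h y \<in> {1..n} \<rightarrow>\<^sub>E UNIV" "h z \<in> {1..n} \<rightarrow>\<^sub>E UNIV"
        using h yz by (simp_all add: config_def)
      fix i assume i: "i \<in> {1..n}"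
      show "h y i = h z i"
      proof (cases "i \<in> ?I")
        case True
        then show ?thesis using fun_cong[OF eq, of i] by simp
      next
        case False
        then show ?thesis using i yz by auto
      qed
    qed
  qed
  moreover have "(\<lambda>z. restrict z ?I) ` h ` config n \<subseteq> ?I \<rightarrow>\<^sub>E UNIV"
    by (intro image_subsetI) (simp add: restrict_PiE_iff)
  ultimately have "card (h ` config n) \<le> card (?I \<rightarrow>\<^sub>E (UNIV :: bit set))"
    by (intro card_inj_on_le finite_PiE) (auto simp: UNIV_bit)
  then show ?thesis by (simp add: card_PiE_bit)
qed

lemma card_arcs_retraction_ge:
  assumes "m \<le> n" "A \<subseteq> config n" "card A = 2 ^ m" "a \<in> A"
    and h: "boolean_network n h"
    and iso: "isomorphic_networks n (\<lambda>x. if x \<in> A then x else a) h"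
  shows "m * (n - m + 1) \<le> card (parcs (interaction_graph n h))"
proof -
  obtain \<pi> where \<pi>: "\<pi> permutes config n"
    and h_\<pi>: "\<And>x. x \<in> config n \<Longrightarrow> h (\<pi> x) = \<pi> (if x \<in> A then x else a)"
    using iso unfolding isomorphic_networks_def by blast
  have finA: "finite A" using assms(2) finite_config by (rule finite_subset)
  have \<pi>a: "\<pi> a \<in> config n" using permutes_in_image[OF \<pi>] assms(2,4) by auto
  \<comment> \<open>Since \<open>a\<close> lies in \<open>A\<close>, \<open>\<pi> a\<close> is a
    fixed point and hence a value of \<open>h\<close>, so \<open>I\<close> consists exactly of the
    nonconstant components.\<close>
  define I where "I = {i \<in> {1..n}. \<exists>y\<in>config n. h y i \<noteq> \<pi> a i}"
  have "\<pi> ` A \<subseteq> h ` config n"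
  proof clarify
    fix x assume "x \<in> A"
    then have "\<pi> x = h (\<pi> x)" "\<pi> x \<in> config n"
      using h_\<pi>[of x] assms(2) permutes_in_image[OF \<pi>] by auto
    then show "\<pi> x \<in> h ` config n" by blast
  qed
  then have "card (\<pi> ` A) \<le> card (h ` config n)"
    by (simp add: card_mono)
  then have "2 ^ m \<le> card (h ` config n)"
    using assms(3) permutes_inj_on[OF \<pi>] by (simp add: card_image)
  also have "\<dots> \<le> 2 ^ card I"
    unfolding I_def by (rule card_image_le_nonconstant_components[OF h \<pi>a])
  finally have "m \<le> card I" by simp
  have "n - m + 1 \<le> card (in_neighbours n h i)" if "i \<in> I" for i
  proof -
    obtain y where y: "y \<in> config n" "h y i \<noteq> \<pi> a i" and i: "i \<in> {1..n}"
      using \<open>i \<in> I\<close> by (auto simp: I_def)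
    \<comment> \<open>If \<open>x\<close> were outside \<open>A\<close> or equal to
      \<open>a\<close>, then \<open>h z\<close> would be \<open>\<pi> a\<close>, which differs from
      \<open>h y\<close> at \<open>i\<close>. Excluding \<open>a\<close> makes the bound
      \<open>2 ^ m\<close> strict, which yields the \<open>+ 1\<close> in the in-degree.\<close>
    have "{z \<in> config n. h z i = h y i} \<subseteq> \<pi> ` (A - {a})"
    proof clarify
      fix z assume z: "z \<in> config n" "h z i = h y i"
      then obtain x where x: "x \<in> config n" "z = \<pi> x"
        using permutes_image[OF \<pi>] by blast
      have "x \<in> A - {a}"
        using h_\<pi>[OF x(1)] x(2) z(2) y(2) by (auto split: if_splits)
      then show "z \<in> \<pi> ` (A - {a})" using x(2) by blast
    qed
    then have "card {z \<in> config n. h z i = h y i} \<le> card (A - {a})"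
      using finA by (intro surj_card_le) auto
    also have "\<dots> < 2 ^ m"
      using finA assms(3,4) by simp
    finally have "(2::nat) ^ (n - card (in_neighbours n h i)) < 2 ^ m"
      using card_level_set_ge[OF y(1) i, of h] by linarith
    then have "n - card (in_neighbours n h i) < m" by simp
    then show ?thesis using assms(1) by linarith
  qed
  then have "card I * (n - m + 1) \<le> card (parcs (interaction_graph n h))"
    by (intro card_arcs_ge) (auto simp: I_def)
  then show ?thesis
    using mult_le_mono1[OF \<open>m \<le> card I\<close>] le_trans by blast
qed

theorem theorem3:
  fixes n :: nat
  assumes "n \<ge> 1"
  shows "\<exists>f. boolean_network n f \<and>
    (\<forall>G\<in>interaction_graphs n f. real (card (parcs G)) \<ge> (real n)\<^sup>2 / 9)"
proof -
  \<comment> \<open>This choice balances the factors \<open>m\<close> and \<open>n - m + 1\<close>,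
    whose sum is fixed.\<close>
  define m where "m = (n + 1) div 2"
  have m: "m \<le> n" using assms by (simp add: m_def)
  then have "2 ^ m \<le> card (config n)" by (simp add: card_config)
  then obtain A where A: "A \<subseteq> config n" "card A = 2 ^ m"
    by (rule obtain_subset_with_card_n)
  then obtain a where a: "a \<in> A" by fastforce
  let ?f = "\<lambda>x. if x \<in> A then x else a"
  \<comment> \<open>Each factor on the right is at least \<open>n\<close>, because
    \<open>2 * m\<close> is \<open>n\<close> or \<open>n + 1\<close>.\<close>
  have "n * n \<le> (2 * m) * (2 * (n - m + 1))"
    by (rule mult_le_mono) (use m in \<open>auto simp: m_def\<close>)
  then have le: "n\<^sup>2 \<le> 4 * (m * (n - m + 1))"
    by (simp add: power2_eq_square algebra_simps)
  show ?thesis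
  proof (intro exI[of _ ?f] conjI ballI)
    show "boolean_network n ?f"
      using A(1) a by (auto simp: boolean_network_def)
    fix G assume "G \<in> interaction_graphs n ?f"
    then obtain h where h: "boolean_network n h" "isomorphic_networks n ?f h"
      and G: "G = interaction_graph n h"
      by (auto simp: interaction_graphs_def)
    have "n\<^sup>2 \<le> 4 * card (parcs G)"
      using le card_arcs_retraction_ge[OF m A a h] unfolding G by linarith
    then have "(real n)\<^sup>2 \<le> 4 * real (card (parcs G))"
      by (metis of_nat_le_iff of_nat_mult of_nat_numeral of_nat_power)
    \<comment> \<open>The constant 1/4 obtained here is stronger than 1/9.\<close>
    then show "real (card (parcs G)) \<ge> (real n)\<^sup>2 / 9" by simp
  qed
qed

end
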